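(* Let $\alpha_1,\alpha_2,\beta_1,\beta_2\in[0,1]$ with $\alpha_1+\beta_1=\alpha_2+\beta_2=1$, and let $0<\delta\leqslant 2^{-20}$. Then the set $$\mathrm{BAD}(0,1;\delta)\cap \mathrm{BAD}^*(\alpha_1,\beta_1;\delta)\cap \mathrm{BAD}^*(\alpha_2,\beta_2;\delta)$$ is nonempty.
   Context: For real $t$, $\|t\|$ denotes the distance from $t$ to the nearest integer; $\log$ is the natural logarithm. For $\alpha,\beta\in[0,1]$ with $\alpha+\beta=1$ and $\delta>0$: $$\mathrm{BAD}(\alpha,\beta;\delta)=\Big\{(\xi_1,\xi_2)\in[0,1]^2:\ \inf_{p\in\mathbb{N}}\max\{p^\alpha\|p\xi_1\|,\ p^\beta\|p\xi_2\|\}\geqslant\delta\Big\},$$ $$\mathrm{BAD}^*(\alpha,\beta;\delta)=\Big\{(\xi_1,\xi_2)\in[0,1]^2:\ \inf_{p\in\mathbb{N}}\max\{(p\log(p+1))^\alpha\|p\xi_1\|,\ (p\log(p+1))^\beta\|p\xi_2\|\}\geqslant\delta\Big\}.$$ (Here $p^0=1$, so $\mathrm{BAD}(0,1;\delta)$ consists of pairs with $\inf_p\max\{\|p\xi_1\|,p\|p\xi_2\|\}\geqslant\delta$.) *)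

theory Defs
  imports "HOL-Analysis.Analysis"
begin

definition dist_int :: "real \<Rightarrow> real" where
  "dist_int t = (INF k\<in>(\<int>::real set). \<bar>t - k\<bar>)"

definition BAD :: "real \<Rightarrow> real \<Rightarrow> real \<Rightarrow> (real \<times> real) set" where
  "BAD \<alpha> \<beta> \<delta> = {(\<xi>1, \<xi>2). \<xi>1 \<in> {0..1} \<and> \<xi>2 \<in> {0..1} \<and>
     (INF p\<in>{1::nat..}. max (real p powr \<alpha> * dist_int (real p * \<xi>1))
                              (real p powr \<beta> * dist_int (real p * \<xi>2))) \<ge> \<delta>}"

definition BADstar :: "real \<Rightarrow> real \<Rightarrow> real \<Rightarrow> (real \<times> real) set" where
  "BADstar \<alpha> \<beta> \<delta> = {(\<xi>1, \<xi>2). \<xi>1 \<in> {0..1} \<and> \<xi>2 \<in> {0..1} \<and>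
     (INF p\<in>{1::nat..}. max ((real p * ln (real p + 1)) powr \<alpha> * dist_int (real p * \<xi>1))
                              ((real p * ln (real p + 1)) powr \<beta> * dist_int (real p * \<xi>2))) \<ge> \<delta>}"

end

(*
  Fix xi2 = sqrt 2 - 1, so that p * ||p * xi2|| >= 1/4 for all p; this settles BAD(0,1). For the other
  two sets only those p matter for which ||p * xi2|| is less than delta / (p log(p+1))^beta. Bad
  approximability of sqrt 2 separates them, so that their number in [2^j, 2^(j+1)) is at most
  16 * 2^j * delta / (2^j log(2^j+1))^beta, and the total length in [0,1] of the intervals around a/p
  forbidden to xi1 by these p is of order delta^2 / j. Summed over the p in [N, N^5) this is O(delta^2),
  which is tiny. So xi1 can be found by nested intervals of lengths 1/N_k, where N_(k+1) = N_k^5, in the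
  spirit of Peres and Schlag: intervals forbidden by p < N_k are longer than 1/N_(k+1), which makes
  the number of grid intervals they meet proportional to their length.
*)

theory Submission
  imports Defs
begin

section \<open>Counting integers\<close>

lemma card_ints_between_le:
  fixes u v :: real
  assumes "u \<le> v" and A: "A \<subseteq> {a :: int. u < of_int a \<and> of_int a < v}"
  shows "finite A" and "real (card A) \<le> v - u + 1"
proof -
  have sub: "A \<subseteq> {\<lfloor>u\<rfloor> + 1..\<lceil>v\<rceil> - 1}"
  proof
    fix a assume "a \<in> A"
    then have "u < of_int a" "of_int a < v" using A by auto
    then show "a \<in> {\<lfloor>u\<rfloor> + 1..\<lceil>v\<rceil> - 1}"
      by (auto simp: floor_less_iff less_ceiling_iff add1_zle_eq zle_diff1_eq)
  qed
  then show "finite A" by (rule finite_subset) simp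
  have "card A \<le> card {\<lfloor>u\<rfloor> + 1..\<lceil>v\<rceil> - 1}" using sub by (intro card_mono) auto
  also have "\<dots> = nat (\<lceil>v\<rceil> - 1 - \<lfloor>u\<rfloor>)" by simp
  finally have "real (card A) \<le> real (nat (\<lceil>v\<rceil> - 1 - \<lfloor>u\<rfloor>))" by simp
  also have "\<dots> \<le> v - u + 1"
    using \<open>u \<le> v\<close> by linarith
  finally show "real (card A) \<le> v - u + 1" .
qed

text \<open>After subtracting \<open>u\<close> and dividing by \<open>g\<close> the elements are at
  least 1 apart, so their floors are distinct.\<close>

lemma card_separated_le:
  fixes u v g :: real
  assumes "0 < g" "u \<le> v" and A: "A \<subseteq> {a :: nat. u \<le> real a \<and> real a \<le> v}"
    and sep: "\<And>a b. \<lbrakk>a \<in> A; b \<in> A; a < b\<rbrakk> \<Longrightarrow> g \<le> real b - real a"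
  shows "real (card A) \<le> (v - u) / g + 1"
proof -
  define f where "f a = \<lfloor>(real a - u) / g\<rfloor>" for a :: nat
  have less: "f a < f b" if "a \<in> A" "b \<in> A" "a < b" for a b
  proof -
    have "(real a - u) / g + 1 = (real a - u + g) / g" using \<open>0 < g\<close> by (simp add: add_divide_distrib)
    also have "\<dots> \<le> (real b - u) / g" using sep[OF that] \<open>0 < g\<close> by (intro divide_right_mono) auto
    finally have "(real a - u) / g + 1 \<le> (real b - u) / g" .
    then show ?thesis unfolding f_def by linarith
  qed
  have inj: "inj_on f A"
    by (rule inj_onI) (metis less linorder_neqE_nat less_irrefl)
  have "f ` A \<subseteq> {0..\<lfloor>(v - u) / g\<rfloor>}"
    using A \<open>0 < g\<close> by (force simp: f_def intro!: floor_mono divide_right_mono)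
  then have "card (f ` A) \<le> card {0..\<lfloor>(v - u) / g\<rfloor>}" by (intro card_mono) auto
  then have "card A \<le> nat (\<lfloor>(v - u) / g\<rfloor> + 1)" by (simp add: card_image[OF inj])
  moreover have "0 \<le> (v - u) / g" using assms by simp
  ultimately show ?thesis by linarith
qed

section \<open>Avoiding neighbourhoods of rationals\<close>

text \<open>Cells are closed because the limit of nested cells may be an end point; neighbourhoods
  are open so that the negation gives a non-strict bound.\<close>

definition touches :: "nat \<Rightarrow> nat \<Rightarrow> nat \<Rightarrow> real \<Rightarrow> bool" where
  "touches n j d r \<longleftrightarrow>
     (\<exists>a::int. \<exists>x. real j / real n \<le> x \<and> x \<le> (real j + 1) / real n \<and> \<bar>x - of_int a / real d\<bar> < r)"

text \<open>Outside a trivial case, \<open>N \<le> d\<close> leaves at most \<open>3 * d / N\<close>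
  fractions of denominator \<open>d\<close> near a cell of length \<open>1 / N\<close>. As
  \<open>r\<close> is at least the mesh \<open>1 / (N * Q)\<close>, each neighbourhood meets at most
  \<open>4 * N * Q * r\<close> subcells.\<close>

lemma card_touches_le:
  assumes N: "0 < N" "N \<le> d" and Q: "0 < Q" and r: "1 / real (N * Q) \<le> r"
  shows "real (card {j \<in> {m * Q..<(m + 1) * Q}. touches (N * Q) j d r}) \<le> 12 * real d * r * real Q"
    (is "real (card ?T) \<le> _")
proof (cases "1 / 2 < real d * r")
  \<comment> \<open>Here the bound exceeds the total number \<open>Q\<close> of cells. In the other
    case the margins \<open>d * r\<close> at both ends of the range for \<open>a\<close> together
    add at most 1 to its length.\<close>
  case True
  have "card ?T \<le> card {m * Q..<(m + 1) * Q}" by (intro card_mono) auto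
  then have "real (card ?T) \<le> 1 * real Q" by simp
  also have "\<dots> \<le> (12 * real d * r) * real Q" using True by (intro mult_right_mono) auto
  finally show ?thesis by simp
next
  case False
  have d: "0 < real d" and n: "0 < real (N * Q)" using N Q by auto
  have "0 < 1 / real (N * Q)" using n by (rule divide_pos_pos[OF zero_less_one])
  then have rpos: "0 < r" using r by linarith
  have dN: "1 \<le> real d / real N" using N by simp
  define lo hi where "lo = real d * (real m / real N) - real d * r"
    and "hi = real d * ((real m + 1) / real N) + real d * r"
  define A where "A = {a :: int. lo < of_int a \<and> of_int a < hi}"
  \<comment> \<open>The \<open>- 1\<close> accounts for the width of cell \<open>j\<close>, which
    reaches up to \<open>(j + 1) / (N * Q)\<close>.\<close>
  define u v where "u a = real (N * Q) * (of_int a / real d - r) - 1"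
    and "v a = real (N * Q) * (of_int a / real d + r)" for a :: int
  define B where "B a = {b :: int. u a < of_int b \<and> of_int b < v a}" for a :: int
  have hilo: "hi - lo = real d / real N + 2 * (real d * r)"
    using N by (simp add: lo_def hi_def field_simps)
  then have lohi: "lo \<le> hi" using d rpos by (smt (verit) dN mult_pos_pos)
  have finA: "finite A" and "real (card A) \<le> hi - lo + 1"
    using card_ints_between_le[OF lohi, of A] by (auto simp: A_def)
  then have cA: "real (card A) \<le> 3 * (real d / real N)" using hilo False dN by linarith
  have nr: "1 \<le> real (N * Q) * r" using r n by (simp add: field_simps)
  have B: "finite (B a) \<and> real (card (B a)) \<le> 4 * (real (N * Q) * r)" for a
  proof -
    have uv: "v a - u a = 2 * (real (N * Q) * r) + 1" by (simp add: u_def v_def algebra_simps)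
    then have "u a \<le> v a" using nr by linarith
    from card_ints_between_le[OF this, of "B a"] show ?thesis
      using uv nr by (auto simp: B_def)
  qed
  have "int ` ?T \<subseteq> (\<Union>a\<in>A. B a)"
  proof
    fix b assume "b \<in> int ` ?T"
    then obtain j where j: "b = int j" "m * Q \<le> j" "j < (m + 1) * Q" "touches (N * Q) j d r" by auto
    then obtain a :: int and x where x: "real j / real (N * Q) \<le> x" "x \<le> (real j + 1) / real (N * Q)"
      "\<bar>x - of_int a / real d\<bar> < r" unfolding touches_def by blast
    have "real j + 1 \<le> (real m + 1) * real Q"
      using j(3) by (metis Suc_eq_plus1 Suc_leI of_nat_1 of_nat_add of_nat_le_iff of_nat_mult)
    then have "(real j + 1) / real (N * Q) \<le> ((real m + 1) * real Q) / real (N * Q)"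
      using n by (intro divide_right_mono) auto
    also have "\<dots> = (real m + 1) / real N" using Q by simp
    finally have x2: "x \<le> (real m + 1) / real N" using x(2) by linarith
    have "real m * real Q \<le> real j" using j(2) by (metis of_nat_le_iff of_nat_mult)
    then have "(real m * real Q) / real (N * Q) \<le> real j / real (N * Q)"
      using n by (intro divide_right_mono) auto
    then have x1: "real m / real N \<le> x" using x(1) Q by simp
    have "real m / real N - r < of_int a / real d" "of_int a / real d < (real m + 1) / real N + r"
      using x1 x2 x(3) by linarith+
    then have "real d * (real m / real N - r) < of_int a" "of_int a < real d * ((real m + 1) / real N + r)"
      using d by (simp_all add: field_simps)
    then have "a \<in> A" by (simp add: A_def lo_def hi_def algebra_simps)
    have "real j / real (N * Q) < of_int a / real d + r"
      "of_int a / real d - r < (real j + 1) / real (N * Q)" using x by linarith+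
    then have "real j < real (N * Q) * (of_int a / real d + r)"
      "real (N * Q) * (of_int a / real d - r) < real j + 1"
      using n by (simp_all only: pos_divide_less_eq pos_less_divide_eq mult.commute)
    then have "real j < v a" "u a < real j" unfolding u_def v_def by linarith+
    then have "b \<in> B a" by (simp add: B_def j(1))
    then show "b \<in> (\<Union>a\<in>A. B a)" using \<open>a \<in> A\<close> by blast
  qed
  then have "card (int ` ?T) \<le> card (\<Union>a\<in>A. B a)" using finA B by (intro card_mono) auto
  also have "\<dots> \<le> (\<Sum>a\<in>A. card (B a))" by (rule card_UN_le[OF finA])
  finally have "card ?T \<le> (\<Sum>a\<in>A. card (B a))" by (simp add: card_image)
  then have "real (card ?T) \<le> (\<Sum>a\<in>A. real (card (B a)))" by (metis of_nat_le_iff of_nat_sum)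
  also have "\<dots> \<le> (\<Sum>a\<in>A. 4 * (real (N * Q) * r))" using B by (intro sum_mono) auto
  also have "\<dots> = real (card A) * (4 * (real (N * Q) * r))" by simp
  also have "\<dots> \<le> 3 * (real d / real N) * (4 * (real (N * Q) * r))"
    using nr by (intro mult_right_mono cA) auto
  also have "\<dots> = 12 * real d * r * real Q" using N by (simp add: field_simps)
  finally show ?thesis .
qed

text \<open>Choosing a child interval needs two things at once: it must miss the current family of
  neighbourhoods, and only few of its own children may meet the next family. The first holds for
  at least half of the children, the second fails for less than half of them on average.\<close>

lemma choose_child:
  fixes d :: "'e \<Rightarrow> nat" and r :: "'e \<Rightarrow> real"
  assumes pos: "0 < N" "0 < R" "0 < R'" and fin: "finite X" "finite Y"
    and Y: "\<And>e. e \<in> Y \<Longrightarrow> N \<le> d e \<and> 1 / real (N * R * R') \<le> r e"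
    and sumY: "(\<Sum>e\<in>Y. 12 * real (d e) * r e) \<le> 1 / 8"
    and X: "(\<Sum>e\<in>X. real (card {j \<in> {m * R..<(m + 1) * R}. touches (N * R) j (d e) (r e)})) \<le> real R / 2"
  shows "\<exists>m'\<in>{m * R..<(m + 1) * R}. (\<forall>e\<in>X. \<not> touches (N * R) m' (d e) (r e)) \<and>
    (\<Sum>e\<in>Y. real (card {j \<in> {m' * R'..<(m' + 1) * R'}. touches (N * R * R') j (d e) (r e)})) \<le> real R' / 2"
proof (rule ccontr)
  define C where "C = {m * R..<(m + 1) * R}"
  define T where "T m' e = {j \<in> {m' * R'..<(m' + 1) * R'}. touches (N * R * R') j (d e) (r e)}" for m' e
  define G where "G = {m' \<in> C. \<forall>e\<in>X. \<not> touches (N * R) m' (d e) (r e)}"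
  assume "\<not> ?thesis"
  then have bad: "real R' / 2 < (\<Sum>e\<in>Y. real (card (T m' e)))" if "m' \<in> G" for m'
    using that by (force simp: G_def C_def T_def)
  have finC: "finite C" "finite G" by (auto simp: C_def G_def)
  have "C \<subseteq> G \<union> (\<Union>e\<in>X. {j \<in> C. touches (N * R) j (d e) (r e)})" by (auto simp: G_def)
  then have "card C \<le> card (G \<union> (\<Union>e\<in>X. {j \<in> C. touches (N * R) j (d e) (r e)}))"
    using finC fin by (intro card_mono) auto
  also have "\<dots> \<le> card G + card (\<Union>e\<in>X. {j \<in> C. touches (N * R) j (d e) (r e)})" by (rule card_Un_le)
  also have "\<dots> \<le> card G + (\<Sum>e\<in>X. card {j \<in> C. touches (N * R) j (d e) (r e)})"
    using card_UN_le[OF fin(1)] by (intro add_left_mono)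
  finally have "real (card C) \<le> real (card G + (\<Sum>e\<in>X. card {j \<in> C. touches (N * R) j (d e) (r e)}))"
    by (rule of_nat_mono)
  then have "real (card C) \<le> real (card G) + (\<Sum>e\<in>X. real (card {j \<in> C. touches (N * R) j (d e) (r e)}))"
    by (simp only: of_nat_add of_nat_sum)
  moreover have "card C = R" by (simp add: C_def)
  ultimately have cG: "real R / 2 \<le> real (card G)" using X by (simp add: C_def)
  \<comment> \<open>Double counting of the pairs of a grandchild and a member of \<open>Y\<close>
    touching it: if every child in \<open>G\<close> failed, there would be at least
    \<open>R * R' / 4\<close> pairs, but \<open>sumY\<close> allows only
    \<open>R * R' / 8\<close>.\<close>
  have "real R / 2 * (real R' / 2) \<le> real (card G) * (real R' / 2)"
    using cG by (intro mult_right_mono) auto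
  also have "\<dots> = (\<Sum>m'\<in>G. real R' / 2)" by simp
  also have "\<dots> \<le> (\<Sum>m'\<in>G. \<Sum>e\<in>Y. real (card (T m' e)))" using bad by (intro sum_mono) force
  also have "\<dots> = (\<Sum>e\<in>Y. \<Sum>m'\<in>G. real (card (T m' e)))" by (rule sum.swap)
  also have "\<dots> \<le> (\<Sum>e\<in>Y. 12 * real (d e) * r e * real (R * R'))"
  proof (rule sum_mono)
    fix e assume e: "e \<in> Y"
    have disj: "T m1 e \<inter> T m2 e = {}" if "m1 \<noteq> m2" for m1 m2
    proof -
      have "j div R' = m1" if "j \<in> T m1 e" for j m1
        using that pos by (intro div_nat_eqI) (auto simp: T_def algebra_simps)
      then show ?thesis using \<open>m1 \<noteq> m2\<close> by blast
    qed
    have "(\<Sum>m'\<in>G. card (T m' e)) = card (\<Union>m'\<in>G. T m' e)"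
      using finC disj by (intro card_UN_disjoint[symmetric]) (auto simp: T_def)
    \<comment> \<open>All grandchildren are counted inside the one parent cell of length
      \<open>1 / N\<close>, with \<open>Q = R * R'\<close> in \<open>card_touches_le\<close>; so the
      denominators are compared with \<open>N\<close> and not with \<open>N * R\<close>.\<close>
    also have "\<dots> \<le> card {j \<in> {m * (R * R')..<(m + 1) * (R * R')}. touches (N * (R * R')) j (d e) (r e)}"
    proof (intro card_mono subsetI)
      fix j assume "j \<in> (\<Union>m'\<in>G. T m' e)"
      then obtain m' where m': "m * R \<le> m'" "m' + 1 \<le> (m + 1) * R" "m' * R' \<le> j" "j < (m' + 1) * R'"
        "touches (N * (R * R')) j (d e) (r e)"
        by (auto simp: G_def C_def T_def mult.assoc)
      have "m * R * R' \<le> m' * R'" "(m' + 1) * R' \<le> (m + 1) * R * R'"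
        using m'(1,2) by (intro mult_right_mono; simp)+
      then have "m * R * R' \<le> j" "j < (m + 1) * R * R'" using m'(3,4) by linarith+
      then show "j \<in> {j \<in> {m * (R * R')..<(m + 1) * (R * R')}. touches (N * (R * R')) j (d e) (r e)}"
        using m'(5) by (simp only: mult.assoc atLeastLessThan_iff mem_Collect_eq)
    qed simp
    finally have "(\<Sum>m'\<in>G. real (card (T m' e)))
        \<le> real (card {j \<in> {m * (R * R')..<(m + 1) * (R * R')}. touches (N * (R * R')) j (d e) (r e)})"
      by (metis of_nat_le_iff of_nat_sum)
    also have "\<dots> \<le> 12 * real (d e) * r e * real (R * R')"
      using Y[OF e] pos by (intro card_touches_le) (auto simp: mult.assoc)
    finally show "(\<Sum>m'\<in>G. real (card (T m' e))) \<le> 12 * real (d e) * r e * real (R * R')" .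
  qed
  also have "\<dots> = (\<Sum>e\<in>Y. 12 * real (d e) * r e) * real (R * R')" by (simp only: sum_distrib_right)
  also have "\<dots> \<le> 1 / 8 * real (R * R')" using sumY by (intro mult_right_mono) auto
  finally have "real R * real R' \<le> 0" by simp
  moreover have "0 < real R * real R'" using pos by simp
  ultimately show False by linarith
qed

text \<open>Nested cells of length \<open>1 / N k\<close>. The family \<open>Y (Suc k)\<close> is
  handled in two stages: inside a cell of length \<open>1 / N k\<close> a child is chosen at most
  half of whose own children are touched, and the next step takes an untouched one, of length
  \<open>1 / N (k + 2)\<close>.\<close>

lemma exists_avoiding_point:
  fixes N R :: "nat \<Rightarrow> nat" and Y :: "nat \<Rightarrow> 'e set" and d :: "'e \<Rightarrow> nat" and r :: "'e \<Rightarrow> real"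
  assumes N0: "0 < N 0" and NS: "\<And>k. N (Suc k) = N k * R k"
    and R: "\<And>k. 0 < R k" and fin: "\<And>k. finite (Y k)" and "Y 0 = {}"
    and Y: "\<And>k e. e \<in> Y (Suc k) \<Longrightarrow> N k \<le> d e \<and> 1 / real (N (Suc (Suc k))) \<le> r e"
    and sumY: "\<And>k. (\<Sum>e\<in>Y (Suc k). 12 * real (d e) * r e) \<le> 1 / 8"
  obtains x where "0 \<le> x" "x \<le> 1" "\<And>k e a. e \<in> Y k \<Longrightarrow> r e \<le> \<bar>x - of_int a / real (d e)\<bar>"
proof -
  have Npos: "0 < N k" for k by (induction k) (use N0 R in \<open>auto simp: NS\<close>)
  define Inv where "Inv k m \<longleftrightarrow>
    (\<Sum>e\<in>Y k. real (card {j \<in> {m * R k..<(m + 1) * R k}. touches (N (Suc k)) j (d e) (r e)})) \<le> real (R k) / 2" for k m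
  define step where "step k m m' \<longleftrightarrow> m' \<in> {m * R k..<(m + 1) * R k} \<and>
    (\<forall>e\<in>Y k. \<not> touches (N (Suc k)) m' (d e) (r e))" for k m m'
  have 0: "Inv 0 0" by (simp add: Inv_def \<open>Y 0 = {}\<close>)
  have S: "\<exists>m'. Inv (Suc k) m' \<and> step k m m'" if "Inv k m" for k m
    using choose_child[where N = "N k" and R = "R k" and R' = "R (Suc k)" and X = "Y k" and Y = "Y (Suc k)"
        and d = d and r = r and m = m, OF Npos R R fin fin] Y[of _ k] sumY[of k] that
    unfolding Inv_def step_def NS by (auto simp: NS)
  \<comment> \<open>The choice is pinned to cell 0 at level 0, so that the limit point lies in
    \<open>[0, 1 / N 0]\<close>, hence in the unit interval.\<close>
  obtain M where M: "M 0 = 0" "\<And>k. Inv k (M k)" "\<And>k. step k (M k) (M (Suc k))"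
    using dependent_nat_choice[of "\<lambda>k m. Inv k m \<and> (k = 0 \<longrightarrow> m = 0)" "\<lambda>k m m'. step k m m'"] 0 S
    by (metis nat.distinct(1))
  define I where "I k = {real (M k) / real (N k)..(real (M k) + 1) / real (N k)}" for k
  have sub: "I (Suc k) \<subseteq> I k" for k
  proof -
    have s: "M k * R k \<le> M (Suc k)" "M (Suc k) + 1 \<le> (M k + 1) * R k" using M(3)[of k] by (auto simp: step_def)
    have "real (M k) * real (R k) \<le> real (M (Suc k))" "real (M (Suc k)) + 1 \<le> (real (M k) + 1) * real (R k)"
      using s(1) s(2) by (metis of_nat_le_iff of_nat_mult) (metis s(2) of_nat_le_iff of_nat_mult of_nat_add of_nat_1)
    then have "(real (M k) * real (R k)) / real (N (Suc k)) \<le> real (M (Suc k)) / real (N (Suc k))"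
      "(real (M (Suc k)) + 1) / real (N (Suc k)) \<le> ((real (M k) + 1) * real (R k)) / real (N (Suc k))"
      by (intro divide_right_mono; simp)+
    then have "real (M k) / real (N k) \<le> real (M (Suc k)) / real (N (Suc k))"
      "(real (M (Suc k)) + 1) / real (N (Suc k)) \<le> (real (M k) + 1) / real (N k)"
      using R[of k] by (simp_all add: NS)
    then show ?thesis by (auto simp: I_def)
  qed
  have "\<Inter>(range I) \<noteq> {}"
  proof (rule compact_nest)
    show "compact (I k)" "I k \<noteq> {}" for k using Npos[of k] by (auto simp: I_def divide_right_mono)
    show "I n \<subseteq> I m" if "m \<le> n" for m n using lift_Suc_antimono_le[of I, OF sub that] .
  qed
  then obtain x where x: "\<And>k. x \<in> I k" by auto
  show thesis
  proof (rule that)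
    have "0 \<le> x" "x \<le> 1 / real (N 0)" using x[of 0] M(1) by (auto simp: I_def)
    moreover have "1 / real (N 0) \<le> 1" using N0 by simp
    ultimately show "0 \<le> x" "x \<le> 1" by linarith+
    fix k e and a :: int assume "e \<in> Y k"
    then have "\<not> touches (N (Suc k)) (M (Suc k)) (d e) (r e)" using M(3)[of k] by (auto simp: step_def)
    then show "r e \<le> \<bar>x - of_int a / real (d e)\<bar>"
      using x[of "Suc k"] unfolding touches_def I_def by (auto simp: not_less)
  qed
qed

section \<open>Multiples of the square root of two\<close>

text \<open>Infinite descent: \<open>a\<close> is even, and its half \<open>b\<close> satisfies
  \<open>q^2 = 2 * b^2\<close>, with \<open>b < q\<close> unless \<open>q = 0\<close>.\<close>

lemma square_neq_twice_square:
  fixes a q :: nat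
  assumes "a\<^sup>2 = 2 * q\<^sup>2"
  shows "q = 0"
  using assms
proof (induction q arbitrary: a rule: less_induct)
  case (less q)
  have "even (a\<^sup>2)" using less.prems by simp
  then obtain b where b: "a = 2 * b" by auto
  then have eq: "q\<^sup>2 = 2 * b\<^sup>2" using less.prems by (simp add: power2_eq_square)
  show "q = 0"
  proof (rule ccontr)
    assume "q \<noteq> 0"
    then have "b\<^sup>2 < q\<^sup>2" using eq by (cases "b = 0") auto
    then have "b < q" using power2_less_imp_less by blast
    then have "b = 0" using less.IH eq by blast
    then show False using eq \<open>q \<noteq> 0\<close> by simp
  qed
qed

text \<open>The nonzero integer \<open>2 * q^2 - a^2\<close> is at least 1 in absolute value and
  factors as \<open>(q * sqrt 2 - a) * (q * sqrt 2 + a)\<close>. If the first factor is small, the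
  second is at most \<open>3 * q + 1 / 4\<close>.\<close>

lemma sqrt2_badly_approximable:
  assumes "0 < q"
  shows "1 / (4 * real q) \<le> \<bar>real q * sqrt 2 - of_int a\<bar>"
proof (rule ccontr)
  let ?t = "real q * sqrt 2"
  assume "\<not> ?thesis"
  then have lt: "\<bar>?t - of_int a\<bar> < 1 / (4 * real q)" by simp
  have q: "1 \<le> real q" using assms by simp
  then have "1 / (4 * real q) \<le> 1 / 4" by (simp add: field_simps)
  then have near: "\<bar>?t - of_int a\<bar> < 1 / 4" using lt by linarith
  have "sqrt 2 < 3 / 2" by (rule real_less_lsqrt) (auto simp: power2_eq_square)
  then have t: "0 \<le> ?t" "?t \<le> 3 / 2 * real q" using q by simp_all
  have "(nat \<bar>a\<bar>)\<^sup>2 \<noteq> 2 * q\<^sup>2" using square_neq_twice_square assms by blast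
  then have "int ((nat \<bar>a\<bar>)\<^sup>2) \<noteq> int (2 * q\<^sup>2)" by (metis of_nat_eq_iff)
  then have "a\<^sup>2 \<noteq> 2 * (int q)\<^sup>2" by simp
  then have "1 \<le> \<bar>2 * (int q)\<^sup>2 - a\<^sup>2\<bar>" by linarith
  then have "1 \<le> real_of_int \<bar>2 * (int q)\<^sup>2 - a\<^sup>2\<bar>" by linarith
  also have "\<dots> = \<bar>(?t - of_int a) * (?t + of_int a)\<bar>"
    by (simp add: algebra_simps power2_eq_square)
  also have "\<dots> = \<bar>?t - of_int a\<bar> * \<bar>?t + of_int a\<bar>" by (rule abs_mult)
  also have "\<dots> \<le> \<bar>?t - of_int a\<bar> * (4 * real q)"
    using near t q by (intro mult_left_mono) linarith+
  also have "\<dots> < 1" using lt q by (simp add: field_simps)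
  finally show False by simp
qed

section \<open>Denominators at which sqrt 2 is too well approximated\<close>

text \<open>For positive \<open>q\<close> this says that the second coordinate
  \<open>sqrt 2 - 1\<close> fails the starred condition with exponent \<open>\<beta>\<close>; only
  such \<open>q\<close> restrict the first coordinate.\<close>

definition near_int :: "real \<Rightarrow> real \<Rightarrow> nat \<Rightarrow> bool" where
  "near_int \<delta> \<beta> q \<longleftrightarrow> (\<exists>a::int. \<bar>real q * sqrt 2 - of_int a\<bar> < \<delta> / (real q * ln (real q + 1)) powr \<beta>)"

lemma ln2_ge_half: "1 / 2 \<le> ln (2::real)"
  using ln2_ge_two_thirds by simp

text \<open>Up to a constant, the summand is the length that \<open>q\<close> forbids to the first
  coordinate. A block has at most \<open>16 * P * \<epsilon>\<close> members, each contributing at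
  most \<open>\<delta> / T powr \<alpha>\<close>; since \<open>\<alpha> + \<beta> = 1\<close>, the
  product is \<open>16 * \<delta>^2 / ln (P + 1)\<close> whatever the exponents.\<close>

lemma sum_near_int_dyadic_le:
  fixes \<alpha> \<beta> \<delta> :: real
  assumes ab: "0 \<le> \<alpha>" "0 \<le> \<beta>" "\<alpha> + \<beta> = 1" and "0 < \<delta>" "0 < j"
  shows "(\<Sum>q | q \<in> {2 ^ j..<2 ^ Suc j} \<and> near_int \<delta> \<beta> q. \<delta> / (real q * ln (real q + 1)) powr \<alpha>)
    \<le> 32 * \<delta>\<^sup>2 / real j"
proof -
  define D where "D = {q. q \<in> {2 ^ j..<2 ^ Suc j} \<and> near_int \<delta> \<beta> q}"
  define P :: real where "P = 2 ^ j"
  define T where "T = P * ln (P + 1)"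
  define \<epsilon> where "\<epsilon> = \<delta> / T powr \<beta>"
  have P: "1 \<le> P" by (simp add: P_def)
  have T: "0 < T" using P by (simp add: T_def)
  have \<epsilon>: "0 < \<epsilon>" using T \<open>0 < \<delta>\<close> by (simp add: \<epsilon>_def)
  have q: "P \<le> real q" "real q \<le> 2 * P" "T \<le> real q * ln (real q + 1)" if "q \<in> D" for q
  proof -
    have "2 ^ j \<le> q" "q \<le> 2 * 2 ^ j" using that by (auto simp: D_def)
    then have "real (2 ^ j) \<le> real q" "real q \<le> real (2 * 2 ^ j)" by (simp_all only: of_nat_le_iff)
    then show 1: "P \<le> real q" "real q \<le> 2 * P" by (simp_all add: P_def)
    show "T \<le> real q * ln (real q + 1)"
      unfolding T_def using 1 P by (intro mult_mono) auto
  qed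
  have decr: "\<delta> / (real q * ln (real q + 1)) powr \<gamma> \<le> \<delta> / T powr \<gamma>" if "q \<in> D" "0 \<le> \<gamma>" for q \<gamma>
    using q(1,3)[OF that(1)] P T \<open>0 < \<delta>\<close> that(2) by (intro divide_left_mono powr_mono2 mult_pos_pos) auto
  have near: "\<exists>a::int. \<bar>real q * sqrt 2 - of_int a\<bar> < \<epsilon>" if D: "q \<in> D" for q
  proof -
    obtain a :: int where "\<bar>real q * sqrt 2 - of_int a\<bar> < \<delta> / (real q * ln (real q + 1)) powr \<beta>"
      using D by (auto simp: D_def near_int_def)
    also have "\<dots> \<le> \<epsilon>" unfolding \<epsilon>_def using decr[OF D ab(2)] .
    finally show ?thesis ..
  qed
  have card: "real (card D) \<le> 16 * P * \<epsilon>"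
  proof (cases "D = {}")
    case True
    then show ?thesis using P \<epsilon> by simp
  next
    case False
    then obtain q0 where q0: "q0 \<in> D" by blast
    \<comment> \<open>A single member already forces \<open>1 \<le> 8 * P * \<epsilon>\<close>,
      which absorbs the \<open>+ 1\<close> of the separation count below.\<close>
    obtain a :: int where a: "\<bar>real q0 * sqrt 2 - of_int a\<bar> < \<epsilon>" using near[OF q0] by blast
    have q0pos: "0 < q0" using q(1)[OF q0] P by simp
    then have "1 / (4 * real q0) < \<epsilon>" using sqrt2_badly_approximable[of q0 a] a by linarith
    then have "1 < \<epsilon> * (4 * real q0)" using q0pos by (simp add: field_simps)
    also have "\<dots> \<le> \<epsilon> * (4 * (2 * P))" using q(2)[OF q0] \<epsilon> by (intro mult_left_mono) auto
    finally have one: "1 \<le> 8 * P * \<epsilon>" by (simp add: mult.commute)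
    have "real (card D) \<le> (2 * P - P) / (1 / (8 * \<epsilon>)) + 1"
    proof (rule card_separated_le)
      fix a b assume ab': "a \<in> D" "b \<in> D" "a < b"
      obtain k l :: int where kl: "\<bar>real a * sqrt 2 - of_int k\<bar> < \<epsilon>" "\<bar>real b * sqrt 2 - of_int l\<bar> < \<epsilon>"
        using near ab' by blast
      \<comment> \<open>The difference \<open>b - a\<close> itself brings a multiple of sqrt 2
        within \<open>2 * \<epsilon>\<close> of an integer, so it cannot be small.\<close>
      have "1 / (4 * real (b - a)) \<le> \<bar>real (b - a) * sqrt 2 - of_int (l - k)\<bar>"
        using ab' by (intro sqrt2_badly_approximable) simp
      also have "\<dots> = \<bar>(real b * sqrt 2 - of_int l) - (real a * sqrt 2 - of_int k)\<bar>"
        using ab' by (simp add: of_nat_diff algebra_simps)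
      also have "\<dots> < 2 * \<epsilon>" using kl by linarith
      finally show "1 / (8 * \<epsilon>) \<le> real b - real a"
        using \<epsilon> ab' by (simp add: field_simps of_nat_diff)
    qed (use \<epsilon> P q in auto)
    also have "\<dots> = 8 * P * \<epsilon> + 1" using \<epsilon> by simp
    finally show ?thesis using one by linarith
  qed
  have lnP: "real j / 2 \<le> ln (P + 1)"
  proof -
    have "real j * (1 / 2) \<le> real j * ln 2" by (intro mult_left_mono ln2_ge_half) simp
    also have "\<dots> = ln P" by (simp add: P_def ln_realpow)
    also have "\<dots> \<le> ln (P + 1)" using P by simp
    finally show ?thesis by simp
  qed
  have "(\<Sum>q\<in>D. \<delta> / (real q * ln (real q + 1)) powr \<alpha>) \<le> (\<Sum>q\<in>D. \<delta> / T powr \<alpha>)"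
    using decr ab by (intro sum_mono) auto
  also have "\<dots> = real (card D) * (\<delta> / T powr \<alpha>)" by simp
  also have "\<dots> \<le> 16 * P * \<epsilon> * (\<delta> / T powr \<alpha>)"
    using \<open>0 < \<delta>\<close> by (intro mult_right_mono card) auto
  also have "\<dots> = 16 * P * \<delta>\<^sup>2 / (T powr \<alpha> * T powr \<beta>)" by (simp add: \<epsilon>_def power2_eq_square mult_ac)
  also have "T powr \<alpha> * T powr \<beta> = T" using T ab by (simp flip: powr_add)
  also have "16 * P * \<delta>\<^sup>2 / T = 16 * \<delta>\<^sup>2 / ln (P + 1)" using P by (simp add: T_def)
  also have "\<dots> \<le> 16 * \<delta>\<^sup>2 / (real j / 2)"
    using lnP \<open>0 < j\<close> by (intro divide_left_mono mult_pos_pos) auto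
  finally show ?thesis by (simp add: D_def)
qed

text \<open>Each of the \<open>n\<close> dyadic blocks is charged the bound of the first. For
  \<open>n = 4 * J\<close>, the case applied later, this gives \<open>128 * \<delta>^2\<close>
  independently of \<open>J\<close>.\<close>

lemma sum_near_int_le:
  fixes \<alpha> \<beta> \<delta> :: real
  assumes ab: "0 \<le> \<alpha>" "0 \<le> \<beta>" "\<alpha> + \<beta> = 1" and "0 < \<delta>" "0 < J"
  shows "(\<Sum>q | q \<in> {2 ^ J..<2 ^ (J + n)} \<and> near_int \<delta> \<beta> q. \<delta> / (real q * ln (real q + 1)) powr \<alpha>)
    \<le> real n * (32 * \<delta>\<^sup>2 / real J)"
proof (induction n)
  case 0
  then show ?case by simp
next
  case (Suc n)
  define f where "f q = \<delta> / (real q * ln (real q + 1)) powr \<alpha>" for q :: nat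
  define D where "D u v = {q. q \<in> {2 ^ u..<2 ^ v} \<and> near_int \<delta> \<beta> q}" for u v :: nat
  have "(2::nat) ^ J \<le> 2 ^ (J + n)" by (rule power_increasing) auto
  then have "2 ^ J \<le> q" if "2 ^ (J + n) \<le> q" for q :: nat using that by (rule order_trans)
  then have Un: "D J (J + Suc n) = D J (J + n) \<union> D (J + n) (Suc (J + n))"
    by (auto simp: D_def)
  have "sum f (D J (J + Suc n)) = sum f (D J (J + n)) + sum f (D (J + n) (Suc (J + n)))"
    unfolding Un by (rule sum.union_disjoint) (auto simp: D_def)
  also have "sum f (D (J + n) (Suc (J + n))) \<le> 32 * \<delta>\<^sup>2 / real (J + n)"
    unfolding f_def D_def using assms by (intro sum_near_int_dyadic_le) auto
  also have "\<dots> \<le> 32 * \<delta>\<^sup>2 / real J" using \<open>0 < J\<close> by (intro divide_left_mono) auto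
  also have "sum f (D J (J + n)) \<le> real n * (32 * \<delta>\<^sup>2 / real J)"
    using Suc by (simp add: f_def D_def)
  finally have "sum f (D J (J + Suc n)) \<le> real (Suc n) * (32 * \<delta>\<^sup>2 / real J)"
    by (simp add: distrib_right add_divide_distrib)
  then show ?case unfolding f_def D_def .
qed

text \<open>Makes \<open>2 ^ 16\<close> a safe first scale, below which nothing has to be avoided:
  the closeness is below \<open>2 * 2 powr -20\<close>, but bad approximability keeps it at least
  \<open>1 / (4 * q)\<close>.\<close>

lemma near_int_imp_large:
  assumes "near_int (2 powr -20) \<beta> q" "0 < q" "0 \<le> \<beta>" "\<beta> \<le> 1"
  shows "2 ^ 16 \<le> q"
proof -
  define w where "w = real q * ln (real q + 1)"
  obtain a :: int where a: "\<bar>real q * sqrt 2 - of_int a\<bar> < 2 powr -20 / w powr \<beta>"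
    using assms(1) by (auto simp: near_int_def w_def)
  have "1 * ln 2 \<le> w" unfolding w_def using \<open>0 < q\<close> by (intro mult_mono) auto
  then have w: "1 / 2 \<le> w" using ln2_ge_half by linarith
  have "1 / 2 \<le> w powr \<beta>"
  proof (cases "1 \<le> w")
    case True
    then show ?thesis using ge_one_powr_ge_zero[OF True \<open>0 \<le> \<beta>\<close>] by linarith
  next
    \<comment> \<open>This happens only at \<open>q = 1\<close>, where
      \<open>w = ln 2\<close>.\<close>
    case False
    then have "w powr 1 \<le> w powr \<beta>" using w assms by (intro powr_mono') auto
    then show ?thesis using w by simp
  qed
  then have "2 powr -20 / w powr \<beta> \<le> 2 powr -20 / (1 / 2)"
    by (intro divide_left_mono mult_pos_pos) auto
  then have "1 / (4 * real q) < 2 powr -20 * 2"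
    using a sqrt2_badly_approximable[OF \<open>0 < q\<close>, of a] by simp
  then show ?thesis using \<open>0 < q\<close> by (simp add: field_simps powr_minus)
qed

section \<open>Distance to the nearest integer\<close>

lemma le_dist_int:
  assumes "\<And>k::int. c \<le> \<bar>t - of_int k\<bar>"
  shows "c \<le> dist_int t"
  unfolding dist_int_def using assms by (intro cINF_greatest) (auto simp: Ints_def)

lemma le_dist_int_sqrt2:
  assumes "\<And>a::int. c \<le> \<bar>real p * sqrt 2 - of_int a\<bar>"
  shows "c \<le> dist_int (real p * (sqrt 2 - 1))"
proof (rule le_dist_int)
  fix k :: int
  show "c \<le> \<bar>real p * (sqrt 2 - 1) - of_int k\<bar>"
    using assms[of "k + int p"] by (simp add: algebra_simps)
qed

lemma le_cINF_max:
  fixes f g :: "nat \<Rightarrow> real"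
  assumes "\<And>p. 0 < p \<Longrightarrow> \<delta> \<le> f p \<or> \<delta> \<le> g p"
  shows "\<delta> \<le> (INF p\<in>{1::nat..}. max (f p) (g p))"
  using assms by (intro cINF_greatest) (auto simp: le_max_iff_disj)

section \<open>A common point of the three sets, with second coordinate sqrt 2 - 1\<close>

theorem theorem1:
  fixes \<alpha>1 \<alpha>2 \<beta>1 \<beta>2 \<delta> :: real
  assumes "\<alpha>1 \<in> {0..1}" "\<alpha>2 \<in> {0..1}" "\<beta>1 \<in> {0..1}" "\<beta>2 \<in> {0..1}"
    and "\<alpha>1 + \<beta>1 = 1" "\<alpha>2 + \<beta>2 = 1"
    and "0 < \<delta>" "\<delta> \<le> 2 powr (-20)"
  shows "BAD 0 1 \<delta> \<inter> BADstar \<alpha>1 \<beta>1 \<delta> \<inter> BADstar \<alpha>2 \<beta>2 \<delta> \<noteq> {}"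
proof -
  \<comment> \<open>The largest admissible \<open>\<delta>\<close>. The sets grow as
    \<open>\<delta>\<close> decreases, so a point found for \<open>\<Delta>\<close> serves all
    smaller values.\<close>
  define \<Delta> :: real where "\<Delta> = 2 powr -20"
  have \<Delta>: "0 < \<Delta>" "\<Delta> = 1 / 2 ^ 20" by (simp_all add: \<Delta>_def powr_minus)
  define w where "w q = real q * ln (real q + 1)" for q :: nat
  \<comment> \<open>The Boolean index lets one family carry the restrictions of both starred sets; a
    denominator may occur once for each.\<close>
  define A B where "A i = (if i then \<alpha>1 else \<alpha>2)" and "B i = (if i then \<beta>1 else \<beta>2)" for i
  have AB: "0 \<le> A i" "A i \<le> 1" "0 \<le> B i" "B i \<le> 1" "A i + B i = 1" for i
    using assms by (auto simp: A_def B_def)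
  \<comment> \<open>Between \<open>N k\<close> and \<open>N (Suc k)\<close> lie
    \<open>64 * 5 ^ k\<close> dyadic blocks, the first with exponent \<open>16 * 5 ^ k\<close>. The
    ratio is 4 for every \<open>k\<close>, which keeps the sums bounded uniformly.\<close>
  define N R :: "nat \<Rightarrow> nat" where "N k = 2 ^ (16 * 5 ^ k)" and "R k = 2 ^ (64 * 5 ^ k)" for k
  define D where "D k i = {q. q \<in> {N k..<N (Suc k)} \<and> near_int \<Delta> (B i) q}" for k i
  \<comment> \<open>The shift matches \<open>exists_avoiding_point\<close>, where denominators in
    \<open>Y (Suc k)\<close> start at \<open>N k\<close> and \<open>Y 0\<close> is empty.\<close>
  define Y where "Y k = (case k of 0 \<Rightarrow> {} | Suc k \<Rightarrow> Sigma UNIV (D k))" for k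
  define r where "r e = \<Delta> / (real (snd e) * w (snd e) powr A (fst e))" for e
  have YS: "Y (Suc k) = Sigma UNIV (D k)" for k by (simp add: Y_def)
  have N5: "N (Suc k) = N k ^ 5" for k by (simp add: N_def flip: power_mult)
  have N16: "2 ^ 16 \<le> N k" for k unfolding N_def by (rule power_increasing) auto
  have finD: "finite (D k i)" for k i by (simp add: D_def)
  obtain x where x: "0 \<le> x" "x \<le> 1" "\<And>k e a. e \<in> Y k \<Longrightarrow> r e \<le> \<bar>x - of_int a / real (snd e)\<bar>"
  proof (rule exists_avoiding_point[of N R Y snd r])
    show "0 < N 0" "0 < R k" "N (Suc k) = N k * R k" for k
      by (simp_all add: N_def R_def flip: power_add)
    show "Y 0 = {}" "finite (Y k)" for k using finD by (auto simp: Y_def split: nat.splits)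
    fix k
    show "N k \<le> snd e \<and> 1 / real (N (Suc (Suc k))) \<le> r e" if "e \<in> Y (Suc k)" for e
    proof -
      define q i where "q = snd e" and "i = fst e"
      have q: "N k \<le> q" "q \<le> N (Suc k)" using that by (auto simp: YS D_def q_def)
      then have "2 ^ 16 \<le> q" using N16[of k] by linarith
      then have q16: "65536 \<le> real q" by simp
      have "real q * 1 \<le> w q"
      proof -
        have "exp 1 \<le> real q + 1" using exp_le q16 by linarith
        then have "1 \<le> ln (real q + 1)" using q16 by (subst ln_ge_iff) auto
        then show ?thesis unfolding w_def by (intro mult_left_mono) auto
      qed
      then have "w q powr A i \<le> w q powr 1" using q16 AB by (intro powr_mono) auto
      moreover have "w q \<le> real q * real q" unfolding w_def using ln_add_one_self_le_self[of "real q"]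
        by (intro mult_left_mono) (auto simp: add.commute)
      moreover have "0 < w q" using \<open>real q * 1 \<le> w q\<close> q16 by simp
      ultimately have wA: "w q powr A i \<le> real q * real q" "0 < w q powr A i" by simp_all
      \<comment> \<open>The fifth power enters here: the radius is at least
        \<open>\<Delta> / q ^ 3\<close>, and \<open>q ^ 2 \<ge> 2 ^ 20\<close> makes this at least
        \<open>1 / q ^ 5\<close>.\<close>
      have "q ^ 5 \<le> N (Suc (Suc k))" unfolding N5[of "Suc k"] using q(2) by (intro power_mono) auto
      then have "real q ^ 5 \<le> real (N (Suc (Suc k)))" by (metis of_nat_le_iff of_nat_power)
      then have "1 / real (N (Suc (Suc k))) \<le> 1 / real q ^ 5"
        using q16 by (intro divide_left_mono mult_pos_pos) (auto simp: N_def)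
      also have "\<dots> = (1 / (real q * real q)) / (real q * (real q * real q))" by (simp add: power_def)
      also have "\<dots> \<le> \<Delta> / (real q * (real q * real q))"
      proof (rule divide_right_mono)
        have "65536 * 65536 \<le> real q * real q" using q16 by (intro mult_mono) auto
        then have "2 ^ 20 \<le> real q * real q" by simp
        then show "1 / (real q * real q) \<le> \<Delta>" unfolding \<Delta>(2) using q16 by (intro divide_left_mono) auto
      qed simp
      also have "\<dots> \<le> \<Delta> / (real q * w q powr A i)"
        using wA q16 \<Delta>(1) by (intro divide_left_mono mult_left_mono mult_pos_pos) auto
      finally show ?thesis using q(1) by (simp add: r_def q_def i_def)
    qed
    have "(\<Sum>e\<in>Y (Suc k). 12 * real (snd e) * r e) = (\<Sum>i\<in>UNIV. \<Sum>q\<in>D k i. 12 * real q * r (i, q))"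
      unfolding YS by (subst sum.Sigma) (auto simp: finD split_beta)
    also have "\<dots> = (\<Sum>i\<in>UNIV. \<Sum>q\<in>D k i. 12 * (\<Delta> / w q powr A i))"
      using N16[of k] by (intro sum.cong refl) (auto simp: D_def r_def)
    also have "\<dots> = (\<Sum>i\<in>UNIV. 12 * (\<Sum>q\<in>D k i. \<Delta> / w q powr A i))"
      by (simp only: sum_distrib_left)
    also have "\<dots> \<le> (\<Sum>i\<in>(UNIV::bool set). 12 * (128 * \<Delta>\<^sup>2))"
    proof (intro sum_mono mult_left_mono)
      fix i
      have "N (Suc k) = 2 ^ (16 * 5 ^ k + 64 * 5 ^ k)" by (simp add: N_def)
      then show "(\<Sum>q\<in>D k i. \<Delta> / w q powr A i) \<le> 128 * \<Delta>\<^sup>2"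
        using sum_near_int_le[of "A i" "B i" \<Delta> "16 * 5 ^ k" "64 * 5 ^ k"] AB \<Delta>(1)
        by (simp add: D_def w_def N_def)
    qed simp
    also have "\<dots> \<le> 1 / 8" by (simp add: \<Delta>(2) UNIV_bool power2_eq_square)
    finally show "(\<Sum>e\<in>Y (Suc k). 12 * real (snd e) * r e) \<le> 1 / 8" .
  qed blast
  have star: "\<Delta> \<le> w p powr A i * dist_int (real p * x) \<or> \<Delta> \<le> w p powr B i * dist_int (real p * (sqrt 2 - 1))"
    if "0 < p" for p i
  proof -
    have "0 < w p" using that by (simp add: w_def)
    then have wpos: "0 < w p powr c" for c by simp
    show ?thesis
    proof (cases "near_int \<Delta> (B i) p")
      case True
      then have p16: "N 0 \<le> p" using near_int_imp_large[of "B i" p] AB that by (simp add: \<Delta>_def N_def)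
      have "p < 2 ^ p" by (rule less_exp)
      also have "\<dots> \<le> N p"
      proof -
        have "p < 5 ^ p" by (rule less_exp[THEN less_le_trans]) (simp add: power_mono)
        then show ?thesis unfolding N_def by (intro power_increasing) auto
      qed
      finally have "p < N p" .
      \<comment> \<open>The least such \<open>k\<close> places \<open>p\<close> between consecutive
        scales; \<open>N 0 \<le> p\<close> excludes \<open>k = 0\<close>.\<close>
      then obtain k where k: "p < N k" "\<And>l. l < k \<Longrightarrow> \<not> p < N l"
        using LeastI[of "\<lambda>k. p < N k"] not_less_Least[of _ "\<lambda>k. p < N k"] by blast
      then obtain l where l: "k = Suc l" using p16 by (cases k) auto
      then have "(i, p) \<in> Y (Suc l)" using k True by (auto simp: YS D_def not_less)
      then have "\<Delta> / (real p * w p powr A i) \<le> \<bar>x - of_int a / real p\<bar>" for a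
        using x(3)[of "(i, p)" "Suc l" a] by (simp add: r_def)
      then have "real p * (\<Delta> / (real p * w p powr A i)) \<le> real p * \<bar>x - of_int a / real p\<bar>" for a
        by (intro mult_left_mono) auto
      moreover have "real p * \<bar>x - of_int a / real p\<bar> = \<bar>real p * x - of_int a\<bar>" for a
        using that by (simp add: abs_mult_pos' right_diff_distrib)
      ultimately have "\<Delta> / w p powr A i \<le> \<bar>real p * x - of_int a\<bar>" for a using that by simp
      then have "\<Delta> / w p powr A i \<le> dist_int (real p * x)" by (rule le_dist_int)
      then show ?thesis using wpos by (simp add: field_simps)
    next
      case False
      then have "\<Delta> / w p powr B i \<le> \<bar>real p * sqrt 2 - of_int a\<bar>" for a :: int
        by (auto simp: near_int_def w_def not_less)
      then have "\<Delta> / w p powr B i \<le> dist_int (real p * (sqrt 2 - 1))" by (rule le_dist_int_sqrt2)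
      then show ?thesis using wpos by (simp add: field_simps)
    qed
  qed
  have \<delta>: "\<delta> \<le> \<Delta>" using assms by (simp add: \<Delta>_def)
  have "sqrt 2 \<le> 2" by (rule real_le_lsqrt) auto
  then have x2: "0 \<le> sqrt 2 - 1" "sqrt 2 - 1 \<le> 1" by simp_all
  have "(x, sqrt 2 - 1) \<in> BADstar (A i) (B i) \<delta>" for i
  proof -
    have "\<delta> \<le> (INF p\<in>{1::nat..}. max (w p powr A i * dist_int (real p * x))
                                      (w p powr B i * dist_int (real p * (sqrt 2 - 1))))"
      using star[of _ i] \<delta> by (intro le_cINF_max) (meson order_trans)
    then show ?thesis unfolding BADstar_def w_def using x(1,2) x2 by simp
  qed
  from this[of True] this[of False]
  have "(x, sqrt 2 - 1) \<in> BADstar \<alpha>1 \<beta>1 \<delta> \<inter> BADstar \<alpha>2 \<beta>2 \<delta>" by (simp add: A_def B_def)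
  moreover have "(x, sqrt 2 - 1) \<in> BAD 0 1 \<delta>"
  proof -
    \<comment> \<open>The second coordinate alone suffices at every \<open>p\<close>, even with 1/4
      in place of \<open>\<delta>\<close>.\<close>
    have "\<delta> \<le> real p powr 1 * dist_int (real p * (sqrt 2 - 1))" if "0 < p" for p
    proof -
      have "1 / (4 * real p) \<le> dist_int (real p * (sqrt 2 - 1))"
        using sqrt2_badly_approximable[OF that] by (rule le_dist_int_sqrt2)
      then have "1 / 4 \<le> real p * dist_int (real p * (sqrt 2 - 1))" using that by (simp add: field_simps)
      moreover have "\<Delta> \<le> 1 / 4" by (simp add: \<Delta>(2))
      ultimately show ?thesis using \<delta> by simp
    qed
    then have "\<delta> \<le> (INF p\<in>{1::nat..}. max (real p powr 0 * dist_int (real p * x))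
                                           (real p powr 1 * dist_int (real p * (sqrt 2 - 1))))"
      by (intro le_cINF_max) blast
    then show ?thesis unfolding BAD_def using x(1,2) x2 by simp
  qed
  ultimately show ?thesis by blast
qed

end
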